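(* Let $(D_\lambda)_{\lambda\in\Lambda}$ be a family of integral domains and let $T$ be a subring of $R=\prod_{\lambda\in\Lambda}D_\lambda$ such that for every $Z\subseteq\Lambda$ there exists some $x\in T$ with $Z=z(x)$. Then the map $\mathcal{F}\mapsto(0)_{\mathcal{F}}^T$ is a bijection from the set of ultrafilters on $\Lambda$ to the set of minimal prime ideals of $T$.
   Context: Subrings contain the identity of $R$. For $x=(x_\lambda)\in R$, $z(x)=\{\lambda\in\Lambda\mid x_\lambda=0\}$. For an ultrafilter $\mathcal{F}$ on the set $\Lambda$, $(0)_{\mathcal{F}}^T=\{x\in T\mid z(x)\in\mathcal{F}\}$. *)

theory Defs
  imports "HOL-Algebra.Algebra"
begin

text \<open>The product of a family of rings, the ring analogue of \<^const>\<open>product_group\<close>. Its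
  elements are extensional functions, so that equality in the product is equality of all
  components with index in the index set.\<close>

definition product_ring :: "'i set \<Rightarrow> ('i \<Rightarrow> ('a, 'm) ring_scheme) \<Rightarrow> ('i \<Rightarrow> 'a) ring"
  where "product_ring I D =
    \<lparr>carrier = (\<Pi>\<^sub>E i\<in>I. carrier (D i)),
     monoid.mult = (\<lambda>x y. \<lambda>i\<in>I. x i \<otimes>\<^bsub>D i\<^esub> y i),
     monoid.one = (\<lambda>i\<in>I. \<one>\<^bsub>D i\<^esub>),
     ring.zero = (\<lambda>i\<in>I. \<zero>\<^bsub>D i\<^esub>),
     ring.add = (\<lambda>x y. \<lambda>i\<in>I. x i \<oplus>\<^bsub>D i\<^esub> y i)\<rparr>"

lemma product_ring_simps [simp]:
  "carrier (product_ring I D) = (\<Pi>\<^sub>E i\<in>I. carrier (D i))"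
  "x \<otimes>\<^bsub>product_ring I D\<^esub> y = (\<lambda>i\<in>I. x i \<otimes>\<^bsub>D i\<^esub> y i)"
  "\<one>\<^bsub>product_ring I D\<^esub> = (\<lambda>i\<in>I. \<one>\<^bsub>D i\<^esub>)"
  "\<zero>\<^bsub>product_ring I D\<^esub> = (\<lambda>i\<in>I. \<zero>\<^bsub>D i\<^esub>)"
  "x \<oplus>\<^bsub>product_ring I D\<^esub> y = (\<lambda>i\<in>I. x i \<oplus>\<^bsub>D i\<^esub> y i)"
  by (simp_all add: product_ring_def)

lemma cring_product_ring:
  assumes D: "\<And>i. i \<in> I \<Longrightarrow> cring (D i)"
  shows "cring (product_ring I D)"
proof (rule cringI)
  note simprules = cring.cring_simprules(1,2,3,5,6,7,8,9,10,11,12,13,14)[OF D]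
  show "abelian_group (product_ring I D)"
  proof (rule abelian_groupI)
    fix x assume x: "x \<in> carrier (product_ring I D)"
    then have "(\<lambda>i\<in>I. \<ominus>\<^bsub>D i\<^esub> x i) \<in> carrier (product_ring I D)"
      by (auto simp: PiE_iff intro: simprules)
    moreover have "(\<lambda>i\<in>I. \<ominus>\<^bsub>D i\<^esub> x i) \<oplus>\<^bsub>product_ring I D\<^esub> x = \<zero>\<^bsub>product_ring I D\<^esub>"
      using x by (auto simp: PiE_iff simprules(8) intro!: restrict_ext)
    ultimately show "\<exists>y\<in>carrier (product_ring I D). y \<oplus>\<^bsub>product_ring I D\<^esub> x = \<zero>\<^bsub>product_ring I D\<^esub>"
      by blast
  qed (auto simp: PiE_iff fun_eq_iff restrict_def extensional_def intro: simprules)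
  show "Group.comm_monoid (product_ring I D)"
    by (rule comm_monoidI)
      (auto simp: PiE_iff fun_eq_iff restrict_def extensional_def intro: simprules)
next
  fix x y z
  assume "x \<in> carrier (product_ring I D)" "y \<in> carrier (product_ring I D)"
    "z \<in> carrier (product_ring I D)"
  then show "(x \<oplus>\<^bsub>product_ring I D\<^esub> y) \<otimes>\<^bsub>product_ring I D\<^esub> z =
    x \<otimes>\<^bsub>product_ring I D\<^esub> z \<oplus>\<^bsub>product_ring I D\<^esub> y \<otimes>\<^bsub>product_ring I D\<^esub> z"
    by (auto simp: PiE_iff cring.cring_simprules(13)[OF D] intro!: restrict_ext)
qed

text \<open>Filters are sets of subsets of the index set \<open>S\<close> and are required to be proper.
  The type \<^typ>\<open>'a filter\<close> is not used: its filters live on a whole type and include the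
  improper one.\<close>

definition proper_filter_on :: "'i set \<Rightarrow> 'i set set \<Rightarrow> bool"
  where "proper_filter_on S F \<longleftrightarrow>
    F \<subseteq> Pow S \<and> S \<in> F \<and> {} \<notin> F \<and>
    (\<forall>A\<in>F. \<forall>B\<in>F. A \<inter> B \<in> F) \<and>
    (\<forall>A\<in>F. \<forall>B. A \<subseteq> B \<and> B \<subseteq> S \<longrightarrow> B \<in> F)"

definition ultrafilter_on :: "'i set \<Rightarrow> 'i set set \<Rightarrow> bool"
  where "ultrafilter_on S F \<longleftrightarrow>
    proper_filter_on S F \<and> (\<forall>A. A \<subseteq> S \<longrightarrow> A \<in> F \<or> S - A \<in> F)"

lemma ultrafilter_on_iff_maximal:
  "ultrafilter_on S F \<longleftrightarrow>
    proper_filter_on S F \<and> (\<forall>G. proper_filter_on S G \<and> F \<subseteq> G \<longrightarrow> G = F)"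
proof (intro iffI conjI allI impI)
  fix G assume F: "ultrafilter_on S F" and G: "proper_filter_on S G \<and> F \<subseteq> G"
  have "A \<in> F" if "A \<in> G" for A
  proof (rule ccontr)
    assume "A \<notin> F"
    moreover have "A \<subseteq> S" using G that by (auto simp: proper_filter_on_def)
    ultimately have "S - A \<in> G" using F G by (auto simp: ultrafilter_on_def)
    then have "A \<inter> (S - A) \<in> G" using G that unfolding proper_filter_on_def by blast
    then show False using G by (simp add: proper_filter_on_def)
  qed
  then show "G = F" using G by blast
next
  assume *: "proper_filter_on S F \<and> (\<forall>G. proper_filter_on S G \<and> F \<subseteq> G \<longrightarrow> G = F)"
  have F: "proper_filter_on S F" using * by blast
  show "ultrafilter_on S F"
    unfolding ultrafilter_on_def
  proof (intro conjI F allI impI)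
    fix A assume A: "A \<subseteq> S"
    define G where "G = {B. B \<subseteq> S \<and> (\<exists>C\<in>F. A \<inter> C \<subseteq> B)}"
    have XF: "S \<in> F" and I: "\<And>C C'. C \<in> F \<Longrightarrow> C' \<in> F \<Longrightarrow> C \<inter> C' \<in> F"
      and U: "\<And>C B. C \<in> F \<Longrightarrow> C \<subseteq> B \<Longrightarrow> B \<subseteq> S \<Longrightarrow> B \<in> F" and P: "F \<subseteq> Pow S"
      using F by (auto simp: proper_filter_on_def)
    show "A \<in> F \<or> S - A \<in> F"
    proof (cases "{} \<in> G")
      case True
      then obtain C where "C \<in> F" "A \<inter> C \<subseteq> {}" by (auto simp: G_def)
      then have "C \<subseteq> S - A" using P by blast
      then show ?thesis using U[OF \<open>C \<in> F\<close>] by blast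
    next
      case False
      have "B \<inter> B' \<in> G" if "B \<in> G" "B' \<in> G" for B B'
      proof -
        from that obtain C C' where "C \<in> F" "C' \<in> F" "A \<inter> C \<subseteq> B" "A \<inter> C' \<subseteq> B'"
          and "B \<subseteq> S" by (auto simp: G_def)
        then show ?thesis unfolding G_def using I[of C C'] by blast
      qed
      moreover have "S \<in> G" using XF A by (auto simp: G_def)
      moreover have "G \<subseteq> Pow S" by (auto simp: G_def)
      moreover have "B' \<in> G" if "B \<in> G" "B \<subseteq> B'" "B' \<subseteq> S" for B B'
        using that unfolding G_def by (blast intro: subset_trans)
      ultimately have "proper_filter_on S G"
        using False unfolding proper_filter_on_def by (intro conjI ballI allI impI) auto
      moreover have "F \<subseteq> G" using P by (auto simp: G_def)
      ultimately have "G = F" using * by simp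
      moreover have "A \<in> G" using XF A by (auto simp: G_def)
      ultimately show ?thesis by blast
    qed
  qed
qed (auto simp: ultrafilter_on_def)

definition zero_set :: "'i set \<Rightarrow> ('i \<Rightarrow> ('a, 'm) ring_scheme) \<Rightarrow> ('i \<Rightarrow> 'a) \<Rightarrow> 'i set"
  where "zero_set I D x = {i \<in> I. x i = \<zero>\<^bsub>D i\<^esub>}"

definition ultrafilter_ideal ::
  "'i set \<Rightarrow> ('i \<Rightarrow> ('a, 'm) ring_scheme) \<Rightarrow> ('i \<Rightarrow> 'a) set \<Rightarrow> 'i set set \<Rightarrow> ('i \<Rightarrow> 'a) set"
  where "ultrafilter_ideal I D T F = {x \<in> T. zero_set I D x \<in> F}"

definition minimal_primeideal :: "'a set \<Rightarrow> ('a, 'm) ring_scheme \<Rightarrow> bool"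
  where "minimal_primeideal P R \<longleftrightarrow>
    primeideal P R \<and> (\<forall>Q. primeideal Q R \<and> Q \<subseteq> P \<longrightarrow> Q = P)"

end

theory Submission
  imports Defs
begin

text \<open>If a prime \<open>Q\<close> lies in \<open>(0)\<^sub>F\<close> and \<open>x \<in> (0)\<^sub>F\<close>, choose \<open>y \<in> T\<close> whose zero set is the
  complement of \<open>z(x)\<close>. Then \<open>x y = 0 \<in> Q\<close> while \<open>y \<notin> (0)\<^sub>F\<close>, so \<open>x \<in> Q\<close>; hence the prime
  \<open>(0)\<^sub>F\<close> is minimal. Conversely, for any prime \<open>P\<close> the zero sets of the elements outside \<open>P\<close>
  are closed under finite unions and do not include \<open>\<Lambda>\<close>, so their complements lie in a common
  ultrafilter \<open>F\<close>, and then \<open>(0)\<^sub>F \<subseteq> P\<close>. Finally, \<open>F\<close> is recovered as the set of zero sets of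
  elements of \<open>(0)\<^sub>F\<close>.\<close>

section \<open>Extending filter bases to ultrafilters\<close>

text \<open>Two members of the union already lie in a common filter of the chain, so closure under
  intersection is inherited. A nonempty chain is required to get \<open>S\<close> into the
  union.\<close>

lemma proper_filter_on_Union_chain:
  assumes "C \<noteq> {}" and "subset.chain {F. proper_filter_on S F} C"
  shows "proper_filter_on S (\<Union>C)"
proof -
  have C: "proper_filter_on S F" if "F \<in> C" for F
    using assms(2) that by (auto simp: subset.chain_def)
  have "A \<inter> B \<in> \<Union>C" if "A \<in> \<Union>C" "B \<in> \<Union>C" for A B
  proof -
    obtain F G where "F \<in> C" "G \<in> C" "A \<in> F" "B \<in> G"
      using \<open>A \<in> \<Union>C\<close> \<open>B \<in> \<Union>C\<close> by blast
    moreover have "F \<subseteq> G \<or> G \<subseteq> F"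
      using assms(2) \<open>F \<in> C\<close> \<open>G \<in> C\<close> by (auto simp: subset.chain_def)
    ultimately obtain H where H: "H \<in> C" "A \<in> H" "B \<in> H"
      by blast
    then have "A \<inter> B \<in> H"
      using C[of H] by (simp add: proper_filter_on_def)
    then show ?thesis
      using H by blast
  qed
  moreover have "B \<in> \<Union>C" if "A \<in> \<Union>C" "A \<subseteq> B" "B \<subseteq> S" for A B
    using that C unfolding proper_filter_on_def by blast
  moreover have "\<Union>C \<subseteq> Pow S" "S \<in> \<Union>C" "{} \<notin> \<Union>C"
    using assms(1) C unfolding proper_filter_on_def by blast+
  ultimately show ?thesis
    unfolding proper_filter_on_def by (intro conjI ballI allI impI) auto
qed

lemma proper_filter_on_imp_ultrafilter_on:
  assumes "proper_filter_on S F"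
  obtains U where "ultrafilter_on S U" and "F \<subseteq> U"
proof -
  let ?A = "{G. proper_filter_on S G \<and> F \<subseteq> G}"
  have "\<Union>C \<in> ?A" if "C \<noteq> {}" "subset.chain ?A C" for C
  proof -
    have "subset.chain {G. proper_filter_on S G} C"
      using that(2) by (auto simp: subset.chain_def)
    moreover have "F \<subseteq> \<Union>C"
      using that unfolding subset.chain_def by blast
    ultimately show ?thesis
      using proper_filter_on_Union_chain[OF that(1)] by blast
  qed
  moreover have "?A \<noteq> {}"
    using assms by blast
  ultimately have "\<exists>U\<in>?A. \<forall>G\<in>?A. U \<subseteq> G \<longrightarrow> G = U"
    by (intro subset_Zorn_nonempty)
  then obtain U where U: "U \<in> ?A" "\<forall>G\<in>?A. U \<subseteq> G \<longrightarrow> G = U"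
    by (rule bexE)
  \<comment> \<open>A filter above \<open>U\<close> also contains \<open>F\<close>, so maximality
    within \<open>?A\<close> is maximality among all proper filters, which characterizes
    ultrafilters.\<close>
  then have "proper_filter_on S G \<and> U \<subseteq> G \<longrightarrow> G = U" for G
    by auto
  with U(1) have "ultrafilter_on S U"
    by (simp add: ultrafilter_on_iff_maximal)
  moreover have "F \<subseteq> U"
    using U(1) by simp
  ultimately show thesis
    by (rule that)
qed

text \<open>The upward closure of \<open>B\<close> in \<open>Pow S\<close> is a filter, proper
  because \<open>B\<close> omits the empty set, and it extends to an ultrafilter.\<close>

lemma filter_base_imp_ultrafilter_on:
  assumes "B \<subseteq> Pow S" and "B \<noteq> {}" and "{} \<notin> B"
    and "\<And>V W. V \<in> B \<Longrightarrow> W \<in> B \<Longrightarrow> V \<inter> W \<in> B"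
  obtains U where "ultrafilter_on S U" and "B \<subseteq> U"
proof -
  let ?F = "{A. A \<subseteq> S \<and> (\<exists>V\<in>B. V \<subseteq> A)}"
  have "A \<inter> A' \<in> ?F" if A: "A \<in> ?F" "A' \<in> ?F" for A A'
  proof -
    obtain V W where "V \<in> B" "W \<in> B" "V \<subseteq> A" "W \<subseteq> A'"
      using A by blast
    then have "V \<inter> W \<in> B" "V \<inter> W \<subseteq> A \<inter> A'"
      using assms(4) by auto
    then show ?thesis
      using A by blast
  qed
  moreover have "S \<in> ?F" "{} \<notin> ?F"
    using assms(1-3) by auto
  moreover have "A' \<in> ?F" if "A \<in> ?F" "A \<subseteq> A'" "A' \<subseteq> S" for A A'
    using that by blast
  ultimately have "proper_filter_on S ?F"
    unfolding proper_filter_on_def by (intro conjI ballI allI impI) auto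
  then obtain U where U: "ultrafilter_on S U" "?F \<subseteq> U"
    by (rule proper_filter_on_imp_ultrafilter_on)
  have "B \<subseteq> ?F"
    using assms(1) by blast
  then have "B \<subseteq> U"
    using U(2) by (rule subset_trans)
  with U(1) show thesis
    by (rule that)
qed

section \<open>Ultrafilters, complements and unions\<close>

lemma ultrafilter_on_Diff_iff:
  assumes "ultrafilter_on S F" and "A \<subseteq> S"
  shows "S - A \<in> F \<longleftrightarrow> A \<notin> F"
proof
  assume "S - A \<in> F"
  show "A \<notin> F"
  proof
    assume "A \<in> F"
    with \<open>S - A \<in> F\<close> have "A \<inter> (S - A) \<in> F"
      using assms(1) unfolding ultrafilter_on_def proper_filter_on_def by blast
    then show False
      using assms(1) by (simp add: ultrafilter_on_def proper_filter_on_def)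
  qed
qed (use assms in \<open>auto simp: ultrafilter_on_def\<close>)

text \<open>If neither set were in \<open>F\<close>, both complements would be, and so would their
  intersection, the complement of the union. This is the set-theoretic source of the primality of
  the ideals below.\<close>

lemma ultrafilter_on_Un_iff:
  assumes "ultrafilter_on S F" and "A \<subseteq> S" and "B \<subseteq> S"
  shows "A \<union> B \<in> F \<longleftrightarrow> A \<in> F \<or> B \<in> F"
proof
  have F: "\<And>V W. V \<in> F \<Longrightarrow> W \<in> F \<Longrightarrow> V \<inter> W \<in> F"
    using assms(1) by (simp add: ultrafilter_on_def proper_filter_on_def)
  assume "A \<union> B \<in> F"
  moreover have "S - (A \<union> B) = (S - A) \<inter> (S - B)"
    by blast
  ultimately show "A \<in> F \<or> B \<in> F"
    using F[of "S - A" "S - B"] assms ultrafilter_on_Diff_iff[of S F]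
    by (metis Un_least)
next
  have "\<And>V W. V \<in> F \<Longrightarrow> V \<subseteq> W \<Longrightarrow> W \<subseteq> S \<Longrightarrow> W \<in> F"
    using assms(1) by (simp add: ultrafilter_on_def proper_filter_on_def)
  then show "A \<in> F \<or> B \<in> F \<Longrightarrow> A \<union> B \<in> F"
    using assms by (meson Un_least Un_upper1 Un_upper2)
qed

section \<open>Zero sets in the product ring\<close>

lemma zero_set_subset: "zero_set I D x \<subseteq> I"
  by (auto simp: zero_set_def)

lemma zero_set_eq_index_set_iff:
  assumes "x \<in> carrier (product_ring I D)"
  shows "zero_set I D x = I \<longleftrightarrow> x = \<zero>\<^bsub>product_ring I D\<^esub>"
  using assms by (auto simp: zero_set_def PiE_iff fun_eq_iff extensional_def)

lemma zero_set_one: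
  assumes "\<And>i. i \<in> I \<Longrightarrow> domain (D i)"
  shows "zero_set I D \<one>\<^bsub>product_ring I D\<^esub> = {}"
  using domain.one_not_zero[OF assms] by (auto simp: zero_set_def)

text \<open>Components have no zero divisors, so a product vanishes at an index exactly when one of
  its factors does.\<close>

lemma zero_set_mult:
  assumes "\<And>i. i \<in> I \<Longrightarrow> domain (D i)"
    and "x \<in> carrier (product_ring I D)" and "y \<in> carrier (product_ring I D)"
  shows "zero_set I D (x \<otimes>\<^bsub>product_ring I D\<^esub> y) = zero_set I D x \<union> zero_set I D y"
proof -
  have "x i \<otimes>\<^bsub>D i\<^esub> y i = \<zero>\<^bsub>D i\<^esub> \<longleftrightarrow> x i = \<zero>\<^bsub>D i\<^esub> \<or> y i = \<zero>\<^bsub>D i\<^esub>" if "i \<in> I" for i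
    using domain.integral_iff[OF assms(1)[OF that]] assms(2,3) that by (auto simp: PiE_iff)
  then show ?thesis
    by (auto simp: zero_set_def)
qed

text \<open>Only an inclusion holds, since nonzero components may cancel; upward closure of filters
  makes it sufficient.\<close>

lemma zero_set_add:
  assumes "\<And>i. i \<in> I \<Longrightarrow> ring (D i)"
  shows "zero_set I D x \<inter> zero_set I D y \<subseteq> zero_set I D (x \<oplus>\<^bsub>product_ring I D\<^esub> y)"
proof -
  have "\<zero>\<^bsub>D i\<^esub> \<oplus>\<^bsub>D i\<^esub> \<zero>\<^bsub>D i\<^esub> = \<zero>\<^bsub>D i\<^esub>" if "i \<in> I" for i
    using ring.ring_simprules(2,8)[OF assms[OF that]] by blast
  then show ?thesis
    by (auto simp: zero_set_def)
qed

section \<open>The subring and its zero sets\<close>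

locale zero_set_surjective_subring =
  fixes \<Lambda> :: "'i set" and D :: "'i \<Rightarrow> ('a, 'm) ring_scheme" and T :: "('i \<Rightarrow> 'a) set"
  assumes dom: "\<And>i. i \<in> \<Lambda> \<Longrightarrow> domain (D i)"
    and sub: "subring T (product_ring \<Lambda> D)"
    and surj: "\<And>Z. Z \<subseteq> \<Lambda> \<Longrightarrow> \<exists>x\<in>T. Z = zero_set \<Lambda> D x"
begin

text \<open>This \<open>R\<close> is \<open>T\<close> with the operations of the product, not the
  full product: the prime ideals in question are those of \<open>T\<close>.\<close>

abbreviation "R \<equiv> (product_ring \<Lambda> D)\<lparr>carrier := T\<rparr>"
abbreviation "z \<equiv> zero_set \<Lambda> D"

lemma cring_R: "cring R"
proof -
  interpret P: cring "product_ring \<Lambda> D"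
    by (intro cring_product_ring domain.axioms(1) dom)
  show ?thesis
    using P.subcring_iff[OF subringE(1)[OF sub]] P.subcringI'[OF sub] by blast
qed

sublocale R: cring R
  by (rule cring_R)

lemma in_product: "x \<in> T \<Longrightarrow> x \<in> carrier (product_ring \<Lambda> D)"
  using subringE(1)[OF sub] by blast

lemma z_mult: "x \<in> T \<Longrightarrow> y \<in> T \<Longrightarrow> z (x \<otimes>\<^bsub>R\<^esub> y) = z x \<union> z y"
  using zero_set_mult[OF dom in_product in_product] by simp

lemma z_add: "z x \<inter> z y \<subseteq> z (x \<oplus>\<^bsub>R\<^esub> y)"
  using zero_set_add[of \<Lambda> D x y, OF cring.axioms(1)[OF domain.axioms(1)[OF dom]]] by simp

lemma z_one: "z \<one>\<^bsub>R\<^esub> = {}"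
  using zero_set_one[of \<Lambda> D, OF dom] by simp

lemma z_eq_index_set_iff: "x \<in> T \<Longrightarrow> z x = \<Lambda> \<longleftrightarrow> x = \<zero>\<^bsub>R\<^esub>"
  using zero_set_eq_index_set_iff[OF in_product] by simp

section \<open>Ultrafilter ideals: primality, injectivity, minimality\<close>

text \<open>Through \<open>z\<close>, sums are controlled by intersections and products become
  unions, so the ideal laws and primality translate into the laws of an ultrafilter.\<close>

lemma primeideal_ultrafilter_ideal:
  assumes F: "ultrafilter_on \<Lambda> F"
  shows "primeideal (ultrafilter_ideal \<Lambda> D T F) R" (is "primeideal ?P R")
proof (rule primeidealI)
  have up: "\<And>A B. A \<in> F \<Longrightarrow> A \<subseteq> B \<Longrightarrow> B \<subseteq> \<Lambda> \<Longrightarrow> B \<in> F"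
    and int: "\<And>A B. A \<in> F \<Longrightarrow> B \<in> F \<Longrightarrow> A \<inter> B \<in> F"
    and triv: "\<Lambda> \<in> F" "{} \<notin> F"
    using F by (simp_all add: ultrafilter_on_def proper_filter_on_def)
  have mem: "x \<in> ?P \<longleftrightarrow> x \<in> T \<and> z x \<in> F" for x
    by (simp add: ultrafilter_ideal_def)
  have closed: "x \<otimes>\<^bsub>R\<^esub> y \<in> T" "x \<oplus>\<^bsub>R\<^esub> y \<in> T" if "x \<in> T" "y \<in> T" for x y
    using R.m_closed[of x y] R.a_closed[of x y] that by simp_all
  \<comment> \<open>One equivalence serves twice: right to left it is absorption, left to right it
    is primality.\<close>
  have mult: "x \<otimes>\<^bsub>R\<^esub> y \<in> ?P \<longleftrightarrow> x \<in> ?P \<or> y \<in> ?P" if "x \<in> T" "y \<in> T" for x y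
    using that closed(1)[OF that]
    unfolding mem z_mult[OF that] ultrafilter_on_Un_iff[OF F zero_set_subset zero_set_subset]
    by blast
  show "ideal ?P R"
  proof (rule idealI)
    show "subgroup ?P (add_monoid R)"
    proof (rule group.subgroupI)
      show "group (add_monoid R)"
        by (rule R.add.is_group)
      show "?P \<subseteq> carrier (add_monoid R)"
        by (auto simp: mem)
      have "\<zero>\<^bsub>R\<^esub> \<in> ?P"
        using z_eq_index_set_iff[of "\<zero>\<^bsub>R\<^esub>"] triv(1) R.zero_closed
        by (simp add: mem del: product_ring_simps)
      then show "?P \<noteq> {}"
        by blast
    next
      fix x assume x: "x \<in> ?P"
      \<comment> \<open>Writing the additive inverse of \<open>x\<close> as a multiple of
        \<open>x\<close> reduces closure under negation to absorption.\<close>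
      have m1: "\<ominus>\<^bsub>R\<^esub> \<one>\<^bsub>R\<^esub> \<in> T"
        using R.a_inv_closed[OF R.one_closed] by simp
      have "\<ominus>\<^bsub>R\<^esub> x = (\<ominus>\<^bsub>R\<^esub> \<one>\<^bsub>R\<^esub>) \<otimes>\<^bsub>R\<^esub> x"
        using x R.l_minus[OF R.one_closed, of x] R.l_one[of x] by (simp add: mem del: product_ring_simps)
      also have "\<dots> \<in> ?P"
        using x m1 mult mem by blast
      finally show "inv\<^bsub>add_monoid R\<^esub> x \<in> ?P"
        by (simp add: a_inv_def)
    next
      fix x y assume "x \<in> ?P" "y \<in> ?P"
      then have "x \<oplus>\<^bsub>R\<^esub> y \<in> ?P"
        using closed(2)[of x y] up[OF int z_add zero_set_subset] by (simp add: mem del: product_ring_simps)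
      then show "x \<otimes>\<^bsub>add_monoid R\<^esub> y \<in> ?P"
        by simp
    qed
  next
    fix a x assume "a \<in> ?P" "x \<in> carrier R"
    then show "x \<otimes>\<^bsub>R\<^esub> a \<in> ?P" "a \<otimes>\<^bsub>R\<^esub> x \<in> ?P"
      using mult[of x a] mult[of a x] by (simp_all add: mem del: product_ring_simps)
  qed (rule R.ring_axioms)
  \<comment> \<open>The identity has empty zero set, which no proper filter contains.\<close>
  show "carrier R \<noteq> ?P"
    using R.one_closed z_one triv(2) mem by metis
  show "a \<in> ?P \<or> b \<in> ?P" if "a \<in> carrier R" "b \<in> carrier R" "a \<otimes>\<^bsub>R\<^esub> b \<in> ?P" for a b
    using that mult[of a b] by (simp del: product_ring_simps)
qed (rule cring_R)

lemma inj_on_ultrafilter_ideal: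
  "inj_on (\<lambda>F. ultrafilter_ideal \<Lambda> D T F) {F. ultrafilter_on \<Lambda> F}"
proof (rule inj_onI)
  \<comment> \<open>Every member of \<open>F\<close> is a subset of \<Lambda>, hence by
    \<open>surj\<close> the zero set of an element of \<open>T\<close>, which then belongs to the
    ideal. Thus the ideal determines \<open>F\<close>.\<close>
  have "z ` ultrafilter_ideal \<Lambda> D T F = F" if "ultrafilter_on \<Lambda> F" for F
  proof -
    have "F \<subseteq> Pow \<Lambda>"
      using that by (simp add: ultrafilter_on_def proper_filter_on_def)
    then show ?thesis
      unfolding ultrafilter_ideal_def image_def using surj by blast
  qed
  then show "F = G" if "F \<in> {F. ultrafilter_on \<Lambda> F}" "G \<in> {F. ultrafilter_on \<Lambda> F}"
    "ultrafilter_ideal \<Lambda> D T F = ultrafilter_ideal \<Lambda> D T G" for F G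
    using that by (metis mem_Collect_eq)
qed

lemma minimal_primeideal_ultrafilter_ideal:
  assumes F: "ultrafilter_on \<Lambda> F"
  shows "minimal_primeideal (ultrafilter_ideal \<Lambda> D T F) R" (is "minimal_primeideal ?P R")
  unfolding minimal_primeideal_def
proof (intro conjI allI impI)
  show "primeideal ?P R"
    by (rule primeideal_ultrafilter_ideal[OF F])
next
  fix Q assume "primeideal Q R \<and> Q \<subseteq> ?P"
  then interpret Q: primeideal Q R
    by simp
  have "?P \<subseteq> Q"
  proof
    fix x assume "x \<in> ?P"
    then have x: "x \<in> T" "z x \<in> F"
      by (simp_all add: ultrafilter_ideal_def)
    obtain y where y: "y \<in> T" "\<Lambda> - z x = z y"
      using surj by blast
    have "z y \<notin> F"
      using ultrafilter_on_Diff_iff[OF F zero_set_subset] x(2) y(2) by metis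
    then have "y \<notin> Q"
      using \<open>primeideal Q R \<and> Q \<subseteq> ?P\<close> by (auto simp: ultrafilter_ideal_def)
    \<comment> \<open>The zero sets of \<open>x\<close> and \<open>y\<close> are complementary, so
      their union is \<Lambda> and the product is zero, hence in \<open>Q\<close>.\<close>
    have "z (x \<otimes>\<^bsub>R\<^esub> y) = \<Lambda>"
      using y zero_set_subset[of \<Lambda> D x] unfolding z_mult[OF x(1) y(1)] by blast
    moreover have "x \<otimes>\<^bsub>R\<^esub> y \<in> T"
      using R.m_closed[of x y] x(1) y(1) by simp
    ultimately have "x \<otimes>\<^bsub>R\<^esub> y \<in> Q"
      using z_eq_index_set_iff additive_subgroup.zero_closed[OF Q.is_additive_subgroup] by metis
    then show "x \<in> Q"
      using Q.I_prime[of x y] x(1) y(1) \<open>y \<notin> Q\<close> by simp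
  qed
  then show "Q = ?P"
    using \<open>primeideal Q R \<and> Q \<subseteq> ?P\<close> by blast
qed

section \<open>Surjectivity onto the minimal primes\<close>

lemma primeideal_contains_ultrafilter_ideal:
  assumes "primeideal P R"
  obtains F where "ultrafilter_on \<Lambda> F" and "ultrafilter_ideal \<Lambda> D T F \<subseteq> P"
proof -
  interpret P: primeideal P R
    by (rule assms)
  let ?B = "(\<lambda>x. \<Lambda> - z x) ` (T - P)"
  have "\<one>\<^bsub>R\<^esub> \<in> T - P"
    using P.one_imp_carrier P.I_notcarr R.one_closed by auto
  then have "?B \<subseteq> Pow \<Lambda>" "?B \<noteq> {}"
    by blast+
  \<comment> \<open>An empty complement would come from an element outside \<open>P\<close>
    vanishing everywhere, but zero lies in \<open>P\<close>.\<close>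
  moreover have "{} \<notin> ?B"
  proof
    assume "{} \<in> ?B"
    then obtain x where "x \<in> T - P" "z x = \<Lambda>"
      using zero_set_subset[of \<Lambda> D] by blast
    then show False
      using z_eq_index_set_iff[of x] additive_subgroup.zero_closed[OF P.is_additive_subgroup] by auto
  qed
  \<comment> \<open>The complement of a prime is multiplicatively closed, and products turn
    complements of zero sets into intersections.\<close>
  moreover have "V \<inter> W \<in> ?B" if VW: "V \<in> ?B" "W \<in> ?B" for V W
  proof -
    obtain x y where xy: "x \<in> T - P" "y \<in> T - P" "V = \<Lambda> - z x" "W = \<Lambda> - z y"
      using VW by blast
    then have "x \<otimes>\<^bsub>R\<^esub> y \<in> T - P"
      using P.I_prime[of x y] R.m_closed[of x y] by auto
    moreover have "V \<inter> W = \<Lambda> - z (x \<otimes>\<^bsub>R\<^esub> y)"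
      using xy z_mult[of x y] by blast
    ultimately show ?thesis
      by blast
  qed
  ultimately obtain F where F: "ultrafilter_on \<Lambda> F" "?B \<subseteq> F"
    by (rule filter_base_imp_ultrafilter_on)
  \<comment> \<open>For an element of the ideal outside \<open>P\<close>, both its zero set and the
    complement of that set would lie in \<open>F\<close>.\<close>
  then have "ultrafilter_ideal \<Lambda> D T F \<subseteq> P"
    using ultrafilter_on_Diff_iff[OF F(1) zero_set_subset] by (auto simp: ultrafilter_ideal_def)
  then show thesis
    using that F(1) by blast
qed

text \<open>For surjectivity, a minimal prime contains some ultrafilter ideal; as that ideal is
  itself prime, minimality forces equality.\<close>

lemma bij_betw_ultrafilter_ideal:
  "bij_betw (\<lambda>F. ultrafilter_ideal \<Lambda> D T F) {F. ultrafilter_on \<Lambda> F} {P. minimal_primeideal P R}"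
  unfolding bij_betw_def
proof (intro conjI inj_on_ultrafilter_ideal subset_antisym subsetI)
  fix P assume "P \<in> {P. minimal_primeideal P R}"
  then have P: "primeideal P R" "\<And>Q. primeideal Q R \<Longrightarrow> Q \<subseteq> P \<Longrightarrow> Q = P"
    by (auto simp: minimal_primeideal_def)
  obtain F where "ultrafilter_on \<Lambda> F" "ultrafilter_ideal \<Lambda> D T F \<subseteq> P"
    using primeideal_contains_ultrafilter_ideal[OF P(1)] by blast
  then show "P \<in> (\<lambda>F. ultrafilter_ideal \<Lambda> D T F) ` {F. ultrafilter_on \<Lambda> F}"
    using P(2) primeideal_ultrafilter_ideal by blast
qed (use minimal_primeideal_ultrafilter_ideal in blast)

end

theorem corollary2p27:
  fixes \<Lambda> :: "'i set"
    and D :: "'i \<Rightarrow> ('a, 'm) ring_scheme"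
    and T :: "('i \<Rightarrow> 'a) set"
  assumes "\<And>i. i \<in> \<Lambda> \<Longrightarrow> domain (D i)"
    and "subring T (product_ring \<Lambda> D)"
    and "\<And>Z. Z \<subseteq> \<Lambda> \<Longrightarrow> \<exists>x\<in>T. Z = zero_set \<Lambda> D x"
  shows "bij_betw (\<lambda>F. ultrafilter_ideal \<Lambda> D T F)
    {F. ultrafilter_on \<Lambda> F}
    {P. minimal_primeideal P ((product_ring \<Lambda> D)\<lparr>carrier := T\<rparr>)}"
  by (intro zero_set_surjective_subring.bij_betw_ultrafilter_ideal
      zero_set_surjective_subring.intro assms)

end
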